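(* For integers $n \ge 0$ and $m \ge 0$, let $X_n$ be a uniformly random binary string of length $n$ (each of the $2^n$ strings equally likely), let $N_{n,m}$ be the number of distinct subsequences of $X_n$ of length $m$, and let $\hat N_{n,m} = \mathbb{E}[N_{n,m}]$ (so $\hat N_{n,m}=0$ when $m>n$). Then for all integers $n \ge 1$ and $1 \le m \le n$, \[ \hat N_{n,m} = \hat N_{n-1,m-1} + \tfrac{1}{2}\hat N_{n-1,m}, \] and the initial conditions are $\hat N_{n,n} = 1$ and $\hat N_{n,0} = 1$ for all $n \ge 0$.
   Context: A subsequence of a string $s = s_0 s_1\cdots s_{n-1}$ is a string $s_{i_1}s_{i_2}\cdots s_{i_m}$ with $0\le i_1<i_2<\dots<i_m\le n-1$ (not necessarily contiguous). Subsequences are counted as distinct strings, i.e. different index choices yielding the same string are counted once; the empty string is the unique subsequence of length $0$. *)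

theory Defs
  imports "HOL-Probability.Probability" "HOL-Library.Sublist"
begin

definition random_string :: "nat \<Rightarrow> bool list pmf" where
  "random_string n = pmf_of_set {s. length s = n}"

text \<open>Subsequences are counted as distinct strings, not as index choices.\<close>

definition num_subseqs :: "nat \<Rightarrow> 'a list \<Rightarrow> nat" where
  "num_subseqs m s = card {t. subseq t s \<and> length t = m}"

definition expected_subseqs :: "nat \<Rightarrow> nat \<Rightarrow> real" where
  "expected_subseqs n m =
     measure_pmf.expectation (random_string n) (\<lambda>s. real (num_subseqs m s))"

end

(* A pair (string, subsequence) with both parts nonempty either has equal first letters, and deleting
   both is reversible up to the choice of that letter, or has different first letters, in which case
   the first letter of the string is determined by the subsequence and can be deleted.  Counting pairs
   gives P (n+1) (m+1) = 2 P n m + P n (m+1); divide by 2^(n+1). *)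
theory Submission
  imports Defs
begin

definition subseq_pairs :: "nat \<Rightarrow> nat \<Rightarrow> (bool list \<times> bool list) set" where
  "subseq_pairs n m = {(s, t). length s = n \<and> subseq t s \<and> length t = m}"

lemma finite_bool_lists_length: "finite {s :: bool list. length s = n}"
  using finite_lists_length_eq[of "UNIV :: bool set" n] by simp

lemma card_bool_lists_length: "card {s :: bool list. length s = n} = 2 ^ n"
  using card_lists_length_eq[of "UNIV :: bool set" n] by simp

lemma finite_subseqs: "finite {t. subseq t s \<and> length t = m}"
proof (rule finite_subset)
  show "{t. subseq t s \<and> length t = m} \<subseteq> set (List.subseqs s)"
    by auto
qed simp

lemma finite_subseq_pairs: "finite (subseq_pairs n m)"
proof (rule finite_subset)
  show "subseq_pairs n m \<subseteq> {s. length s = n} \<times> {t. length t = m}"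
    by (auto simp: subseq_pairs_def)
qed (simp add: finite_bool_lists_length)

lemma expected_subseqs_eq_sum:
  "expected_subseqs n m = real (\<Sum>s | length s = n. num_subseqs m (s :: bool list)) / 2 ^ n"
proof -
  have "{s :: bool list. length s = n} \<noteq> {}"
    by (metis (mono_tags) empty_iff length_replicate mem_Collect_eq)
  then show ?thesis
    unfolding expected_subseqs_def random_string_def
    by (simp add: integral_pmf_of_set finite_bool_lists_length card_bool_lists_length)
qed

text \<open>The pairs are fibred over their first component, and the fibre over \<open>s\<close> has
  \<open>num_subseqs m s\<close> elements. This turns the expectation into the size of one finite
  set, on which bijections can act.\<close>

lemma expected_subseqs_eq_card_pairs:
  "expected_subseqs n m = real (card (subseq_pairs n m)) / 2 ^ n"
proof -
  have "subseq_pairs n m = (SIGMA s : {s. length s = n}. {t. subseq t s \<and> length t = m})"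
    by (auto simp: subseq_pairs_def)
  then have "card (subseq_pairs n m) = (\<Sum>s | length s = n. num_subseqs m (s :: bool list))"
    by (simp add: num_subseqs_def finite_bool_lists_length finite_subseqs)
  then show ?thesis
    by (simp add: expected_subseqs_eq_sum)
qed

text \<open>Serves the boundary values \<open>m = 0\<close>, \<open>m = n\<close> and
  \<open>m > n\<close>, where the count does not depend on the string.\<close>

lemma expected_subseqs_const:
  assumes "\<And>s :: bool list. length s = n \<Longrightarrow> num_subseqs m s = c"
  shows "expected_subseqs n m = real c"
  using assms by (simp add: expected_subseqs_eq_sum card_bool_lists_length)

lemma num_subseqs_eq_0: "length s < m \<Longrightarrow> num_subseqs m s = 0"
  unfolding num_subseqs_def using list_emb_length[of "(=)" _ s]
  by (metis (mono_tags, lifting) card.empty empty_Collect_eq leD)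

lemma num_subseqs_length: "num_subseqs (length s) s = 1"
proof -
  have "{t. subseq t s \<and> length t = length s} = {s}"
    using subseq_same_length by auto
  then show ?thesis by (simp add: num_subseqs_def)
qed

lemma num_subseqs_0: "num_subseqs 0 s = 1"
proof -
  have "{t. subseq t s \<and> length t = 0} = {[]}"
    by auto
  then show ?thesis by (simp add: num_subseqs_def)
qed

lemma card_subseq_pairs_Suc:
  "card (subseq_pairs (Suc n) (Suc m)) = 2 * card (subseq_pairs n m) + card (subseq_pairs n (Suc m))"
proof -
  define f :: "bool \<times> bool list \<times> bool list \<Rightarrow> bool list \<times> bool list"
    where "f = (\<lambda>(a, s, t). (a # s, a # t))"
  \<comment> \<open>Over a binary alphabet, \<open>\<not> hd t\<close> is the only letter different
    from the head of \<open>t\<close>. In \<open>B\<close> the list \<open>t\<close> has length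
    \<open>Suc m\<close>, so its head is a genuine letter.\<close>
  define g :: "bool list \<times> bool list \<Rightarrow> bool list \<times> bool list"
    where "g = (\<lambda>(s, t). ((\<not> hd t) # s, t))"
  define A where "A = f ` (UNIV \<times> subseq_pairs n m)"
  define B where "B = g ` subseq_pairs n (Suc m)"
  have "subseq_pairs (Suc n) (Suc m) = A \<union> B"
  proof (intro equalityI subsetI)
    fix p assume "p \<in> subseq_pairs (Suc n) (Suc m)"
    then obtain a s b t where p: "p = (a # s, b # t)" "length s = n" "length t = m"
      "subseq (b # t) (a # s)"
      by (auto simp: subseq_pairs_def length_Suc_conv)
    show "p \<in> A \<union> B"
    proof (cases "a = b")
      case True
      then have "p = f (a, s, t)" "(s, t) \<in> subseq_pairs n m"
        using p by (simp_all add: f_def subseq_pairs_def)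
      then show ?thesis by (auto simp: A_def)
    next
      case False
      \<comment> \<open>Since \<open>a\<close> differs from \<open>b\<close>, no embedding of
        \<open>b # t\<close> can use the leading \<open>a\<close>, so all of \<open>b # t\<close>
        embeds in \<open>s\<close>.\<close>
      then have "p = g (s, b # t)" "(s, b # t) \<in> subseq_pairs n (Suc m)"
        using p by (auto simp: g_def subseq_pairs_def)
      then show ?thesis by (auto simp: B_def)
    qed
  next
    fix p assume "p \<in> A \<union> B"
    then show "p \<in> subseq_pairs (Suc n) (Suc m)"
      by (auto simp: A_def B_def f_def g_def subseq_pairs_def intro: list_emb_Cons)
  qed
  \<comment> \<open>The two heads agree in every pair of \<open>A\<close> and disagree in every pair
    of \<open>B\<close>.\<close>
  moreover have "A \<inter> B = {}"
    by (auto simp: A_def B_def f_def g_def)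
  \<comment> \<open>\<open>f\<close> is injective, and the factor 2 counts the choices of the common
    first letter.\<close>
  moreover have "card A = 2 * card (subseq_pairs n m)"
    unfolding A_def by (subst card_image) (auto simp: inj_on_def f_def card_cartesian_product)
  moreover have "card B = card (subseq_pairs n (Suc m))"
    unfolding B_def by (subst card_image) (auto simp: inj_on_def g_def)
  moreover have "finite A" "finite B"
    by (simp_all add: A_def B_def finite_subseq_pairs)
  ultimately show ?thesis
    by (simp add: card_Un_disjoint)
qed

lemma expected_subseqs_Suc:
  "expected_subseqs (Suc n) (Suc m) = expected_subseqs n m + 1 / 2 * expected_subseqs n (Suc m)"
  by (simp add: expected_subseqs_eq_card_pairs card_subseq_pairs_Suc add_divide_distrib)

theorem theorem1:
  "(\<forall>n m. n < m \<longrightarrow> expected_subseqs n m = 0) \<and>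
   (\<forall>n m. 1 \<le> n \<and> 1 \<le> m \<and> m \<le> n \<longrightarrow>
      expected_subseqs n m =
        expected_subseqs (n - 1) (m - 1) + 1 / 2 * expected_subseqs (n - 1) m) \<and>
   (\<forall>n. expected_subseqs n n = 1) \<and>
   (\<forall>n. expected_subseqs n 0 = 1)"
proof (intro conjI allI impI)
  fix n m :: nat assume "n < m"
  then show "expected_subseqs n m = 0"
    using expected_subseqs_const[of n m 0] num_subseqs_eq_0 by auto
next
  fix n m :: nat assume "1 \<le> n \<and> 1 \<le> m \<and> m \<le> n"
  then show "expected_subseqs n m =
      expected_subseqs (n - 1) (m - 1) + 1 / 2 * expected_subseqs (n - 1) m"
    \<comment> \<open>As \<open>n\<close> and \<open>m\<close> are positive, the truncated
      subtractions are undone by \<open>Suc\<close>.\<close>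
    using expected_subseqs_Suc[of "n - 1" "m - 1"] by simp
next
  fix n :: nat
  show "expected_subseqs n n = 1"
    using expected_subseqs_const[of n n 1] num_subseqs_length by auto
  show "expected_subseqs n 0 = 1"
    using expected_subseqs_const[of n 0 1] num_subseqs_0 by auto
qed

end
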